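(* Let $p$ be a prime, $n$ a positive integer and $q=p^n$. There exists a Costas polynomial $f(x)$ over $\mathbb{F}_q$ if and only if there exists an orthomorphism $g(x)$ of $\mathbb{F}_q$ such that $g(0)=0$ and all of its compositions $g^k(x)$ are also orthomorphisms for $k=1,2,\ldots,q-2$. They are related through the relation $g(x)=f(\alpha f^{-1}(x))$, where $\alpha$ is a primitive element in $\mathbb{F}_q$. Moreover, all Costas polynomials over $\mathbb{F}_q$ are of the form $L(x^s)$, where $L(x)$ is a linearized permutation polynomial and $\gcd(s,q-1)=1$, if and only if the only orthomorphisms $g$ of $\mathbb{F}_q$ such that $g(0)=0$ and all compositions $g^k(x)$, $k=1,2,\ldots,q-2$, are orthomorphisms are those of the form $g(x)=L(\alpha L^{-1}(x))$, where $L(x)$ is a linearized permutation polynomial and $\alpha$ is a primitive element in $\mathbb{F}_q$.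
   Context: $\mathbb{F}_q$ is the finite field of order $q=p^n$. Every map on $\mathbb{F}_q$ is induced by a polynomial in $\mathbb{F}_q[x]$ of degree less than $q$, and polynomials are identified with the maps they induce. A permutation polynomial is a polynomial inducing a permutation of $\mathbb{F}_q$. A Costas polynomial over $\mathbb{F}_q$ is a polynomial $f\in\mathbb{F}_q[x]$ with $f(0)=0$ such that $f(dx)-f(x)$ is a permutation polynomial for all $d\in\mathbb{F}_q$, $d\neq 1$ (taking $d=0$ shows that $f$ itself is a permutation polynomial; $f^{-1}$ denotes its compositional inverse). An orthomorphism of $\mathbb{F}_q$ is a map $\theta:\mathbb{F}_q\to\mathbb{F}_q$ such that both $\theta(x)$ and $\theta(x)-x$ are permutations of $\mathbb{F}_q$. $g^k$ denotes the $k$-fold composition of $g$ with itself. A linearized permutation polynomial of $\mathbb{F}_q$ is a permutation polynomial of the form $L(x)=\sum_{i=0}^{n-1}a_ix^{p^i}$ with $a_i\in\mathbb{F}_q$; $L^{-1}$ is its compositional inverse. A primitive element is a generator of the multiplicative group $\mathbb{F}_q^*$.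
   Formalization: The existence equivalence and the relation g(x)=f(αf^{-1}(x)) are stated only for q≠2: over F_2 the polynomial x is Costas but no orthomorphism exists, so the claim fails there. The "moreover" part covers all q. *)

theory Defs
  imports "HOL-Computational_Algebra.Polynomial" "HOL-Library.Cardinality"
    "HOL-Computational_Algebra.Primes"
begin

text \<open>
  The field of order q is a type of class field and finite with CARD('a) = q. Maps on it are HOL
  functions. The polynomials are formal ones, of unrestricted degree, and two of them are
  identified when they induce the same map, so an identity between polynomials is stated as
  an equation between the functions \<^term>\<open>poly f\<close>.
\<close>

definition permutation_poly :: "'a::{field,finite} poly \<Rightarrow> bool" where
  "permutation_poly f \<longleftrightarrow> bij (poly f)"

definition costas_poly :: "'a::{field,finite} poly \<Rightarrow> bool" where
  "costas_poly f \<longleftrightarrow>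
     poly f 0 = 0 \<and> (\<forall>d. d \<noteq> 1 \<longrightarrow> permutation_poly (pcompose f [:0, d:] - f))"

definition orthomorphism :: "('a::{field,finite} \<Rightarrow> 'a) \<Rightarrow> bool" where
  "orthomorphism \<theta> \<longleftrightarrow> bij \<theta> \<and> bij (\<lambda>x. \<theta> x - x)"

text \<open>
  The field of order 2 has no orthomorphism at all, although the polynomial x is a Costas
  polynomial there. For larger fields the case k = 1 below already contains the first conjunct.
\<close>

definition all_powers_orthomorphism :: "('a::{field,finite} \<Rightarrow> 'a) \<Rightarrow> bool" where
  "all_powers_orthomorphism g \<longleftrightarrow>
     orthomorphism g \<and> g 0 = 0 \<and> (\<forall>k\<in>{1..CARD('a) - 2}. orthomorphism (g ^^ k))"

definition linearized_permutation_poly ::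
    "nat \<Rightarrow> nat \<Rightarrow> 'a::{field,finite} poly \<Rightarrow> bool" where
  "linearized_permutation_poly p n L \<longleftrightarrow>
     permutation_poly L \<and> (\<exists>a. L = (\<Sum>i<n. monom (a i) (p ^ i)))"

definition primitive_element :: "'a::{field,finite} \<Rightarrow> bool" where
  "primitive_element \<alpha> \<longleftrightarrow> range (\<lambda>k::int. \<alpha> powi k) = - {0}"

text \<open>
  The map \<open>x \<mapsto> f (\<alpha> f\<^sup>-\<^sup>1 x)\<close>, where the inverse is the compositional one;
  it is meaningful when f is a permutation polynomial.
\<close>

definition conj_mult :: "'a::{field,finite} poly \<Rightarrow> 'a \<Rightarrow> 'a \<Rightarrow> 'a" where
  "conj_mult f \<alpha> = (\<lambda>x. poly f (\<alpha> * inv (poly f) x))"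

end

theory Submission
  imports "HOL-Algebra.Algebraic_Closure_Type" "HOL-Number_Theory.Cong" Defs
begin

text \<open>
  Conjugating multiplication by a primitive element \<open>\<alpha>\<close> with \<open>f\<close> turns
  \<open>f (\<alpha>\<^sup>k x) - f x\<close> into \<open>g\<^sup>k y - y\<close> at \<open>y = f x\<close>, so Costas maps give orthomorphisms with
  orthomorphic powers. Conversely, \<open>g\<^sup>k - id\<close> is injective and vanishes at 0, so no power
  \<open>g\<^sup>k\<close> with \<open>1 \<le> k \<le> q - 2\<close> fixes a nonzero point; hence \<open>g\<close> permutes the nonzero elements in a
  single cycle and \<open>f (\<alpha>\<^sup>k) = g\<^sup>k 1\<close> defines the conjugating map. For the second part,
  \<open>f \<alpha> f\<^sup>-\<^sup>1 = L \<alpha>\<^sup>s L\<^sup>-\<^sup>1\<close> says that \<open>L\<^sup>-\<^sup>1 f\<close> intertwines multiplication by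
  \<open>\<alpha>\<close> and \<open>\<alpha>\<^sup>s\<close>, which forces it to be \<open>x \<mapsto> c x\<^sup>s\<close>.
\<close>

section \<open>Primitive elements\<close>

lemma finite_field_card_gt_1: "CARD('a::{field,finite}) > 1"
proof -
  have "card {0, 1 :: 'a} \<le> CARD('a)"
    by (intro card_mono) auto
  then show ?thesis by simp
qed

lemma card_nonzero: "card (- {0::'a::{field,finite}}) = CARD('a) - 1"
  by (simp add: Compl_eq_Diff_UNIV card_Diff_singleton)

text \<open>Multiplication by x permutes the nonzero elements, so their product equals itself times
  \<open>x ^ (q - 1)\<close>; that product is nonzero and cancels.\<close>

lemma finite_field_power_card_minus_1:
  fixes x :: "'a::{field,finite}"
  assumes "x \<noteq> 0"
  shows "x ^ (CARD('a) - 1) = 1"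
proof -
  let ?A = "- {0::'a}"
  have "(\<Prod>y\<in>?A. x * y) = (\<Prod>y\<in>?A. y)"
    by (rule prod.reindex_bij_witness[of _ "\<lambda>y. y / x" "\<lambda>y. x * y"]) (use assms in auto)
  moreover have "(\<Prod>y\<in>?A. x * y) = x ^ (CARD('a) - 1) * (\<Prod>y\<in>?A. y)"
    by (simp add: prod.distrib card_nonzero)
  moreover have "(\<Prod>y\<in>?A. y) \<noteq> 0"
    by simp
  ultimately show ?thesis by simp
qed

lemma power_mod_card_minus_1:
  fixes x :: "'a::{field,finite}"
  assumes "x \<noteq> 0"
  shows "x ^ (k mod (CARD('a) - 1)) = x ^ k"
proof -
  have "x ^ k = x ^ ((CARD('a) - 1) * (k div (CARD('a) - 1)) + k mod (CARD('a) - 1))"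
    by simp
  also have "\<dots> = x ^ (k mod (CARD('a) - 1))"
    by (simp only: power_add power_mult finite_field_power_card_minus_1[OF assms]) simp
  finally show ?thesis ..
qed

text \<open>The multiplicative group of a finite field is cyclic. The type is viewed as a ring
  record so that the generator can be taken from the algebraic theory.\<close>

lemma primitive_element_exists: "\<exists>\<alpha>::'a::{field,finite}. primitive_element \<alpha>"
proof -
  define R where "R = (ring_of_type_algebra :: 'a ring)"
  interpret R: field R
    unfolding R_def by rule
  have carrier: "carrier R = UNIV" "carrier (mult_of R) = - {0}"
    by (auto simp: R_def ring_of_type_algebra_def)
  have pow: "x [^]\<^bsub>R\<^esub> k = x ^ k" for x :: 'a and k :: nat
    by (induction k) (simp_all add: R_def ring_of_type_algebra_def mult.commute)
  obtain \<alpha> where \<alpha>: "\<alpha> \<in> carrier (mult_of R)"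
      "carrier (mult_of R) = {\<alpha> [^]\<^bsub>R\<^esub> i | i::nat. i \<in> UNIV}"
    using R.finite_field_mult_group_has_gen carrier by auto
  have "range (\<lambda>k::int. \<alpha> powi k) = - {0}"
  proof
    show "range (\<lambda>k::int. \<alpha> powi k) \<subseteq> - {0}"
      using \<alpha>(1) carrier by auto
    show "- {0} \<subseteq> range (\<lambda>k::int. \<alpha> powi k)"
    proof
      fix x :: 'a assume "x \<in> - {0}"
      then have "x \<in> {\<alpha> ^ i | i::nat. i \<in> UNIV}"
        using \<alpha>(2) unfolding carrier(2) pow by simp
      then obtain i where "x = \<alpha> ^ i"
        by blast
      then show "x \<in> range (\<lambda>k::int. \<alpha> powi k)"
        by (metis power_int_of_nat rangeI)
    qed
  qed
  then show ?thesis
    unfolding primitive_element_def by blast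
qed

lemma primitive_element_nonzero: "primitive_element \<alpha> \<Longrightarrow> \<alpha> \<noteq> 0"
  unfolding primitive_element_def by (metis ComplD insertI1 power_int_1_right rangeI)

text \<open>Since \<open>\<alpha> ^ (q - 1) = 1\<close>, an integer exponent may be replaced by its
  nonnegative remainder modulo q - 1, so natural exponents suffice.\<close>

lemma primitive_element_iff:
  fixes \<alpha> :: "'a::{field,finite}"
  shows "primitive_element \<alpha> \<longleftrightarrow> \<alpha> \<noteq> 0 \<and> (\<forall>x. x \<noteq> 0 \<longrightarrow> (\<exists>k. x = \<alpha> ^ k))"
proof (intro iffI conjI allI impI)
  assume prim: "primitive_element \<alpha>"
  show nz: "\<alpha> \<noteq> 0"
    using prim by (rule primitive_element_nonzero)
  fix x :: 'a assume "x \<noteq> 0"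
  then have "x \<in> range (\<lambda>k::int. \<alpha> powi k)"
    using prim by (simp add: primitive_element_def)
  then obtain k where k: "x = \<alpha> powi k"
    by auto
  define m where "m = int (CARD('a) - 1)"
  have "m > 0"
    using finite_field_card_gt_1[where 'a='a] by (simp add: m_def)
  have "\<alpha> powi k = \<alpha> powi (m * (k div m) + k mod m)"
    by simp
  also have "\<dots> = (\<alpha> powi m) powi (k div m) * \<alpha> powi (k mod m)"
    using nz by (subst power_int_add) (auto simp: power_int_mult)
  also have "\<alpha> powi m = 1"
    unfolding m_def by (simp only: power_int_of_nat finite_field_power_card_minus_1[OF nz])
  also have "\<alpha> powi (k mod m) = \<alpha> ^ nat (k mod m)"
    using \<open>m > 0\<close> by (simp add: power_int_def)
  finally show "\<exists>k. x = \<alpha> ^ k"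
    using k by auto
next
  assume *: "\<alpha> \<noteq> 0 \<and> (\<forall>x. x \<noteq> 0 \<longrightarrow> (\<exists>k. x = \<alpha> ^ k))"
  have "x \<in> range (\<lambda>k::int. \<alpha> powi k)" if "x \<noteq> 0" for x
    using * that by (metis power_int_of_nat rangeI)
  with * show "primitive_element \<alpha>"
    by (auto simp: primitive_element_def)
qed

text \<open>Reducing exponents modulo q - 1 gives surjectivity; injectivity follows because both
  sets have q - 1 elements.\<close>

lemma primitive_element_bij_betw:
  fixes \<alpha> :: "'a::{field,finite}"
  assumes "primitive_element \<alpha>"
  shows "bij_betw (\<lambda>k. \<alpha> ^ k) {..<CARD('a) - 1} (- {0})"
proof -
  have nz: "\<alpha> \<noteq> 0"
    using assms by (rule primitive_element_nonzero)
  have image: "(\<lambda>k. \<alpha> ^ k) ` {..<CARD('a) - 1} = - {0}"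
  proof
    show "- {0} \<subseteq> (\<lambda>k. \<alpha> ^ k) ` {..<CARD('a) - 1}"
    proof
      fix x :: 'a assume "x \<in> - {0}"
      then obtain k where "x = \<alpha> ^ k"
        using assms by (auto simp: primitive_element_iff)
      then have "x = \<alpha> ^ (k mod (CARD('a) - 1))"
        by (simp only: power_mod_card_minus_1[OF nz])
      moreover have "k mod (CARD('a) - 1) \<in> {..<CARD('a) - 1}"
        using finite_field_card_gt_1[where 'a='a] by simp
      ultimately show "x \<in> (\<lambda>k. \<alpha> ^ k) ` {..<CARD('a) - 1}"
        by blast
    qed
  qed (use nz in auto)
  moreover have "inj_on (\<lambda>k. \<alpha> ^ k) {..<CARD('a) - 1}"
    by (rule eq_card_imp_inj_on) (simp_all only: image card_nonzero finite_lessThan card_lessThan)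
  ultimately show ?thesis
    by (simp add: bij_betw_def)
qed

lemma primitive_element_powE:
  fixes \<alpha> :: "'a::{field,finite}"
  assumes "primitive_element \<alpha>" "x \<noteq> 0"
  obtains k where "k < CARD('a) - 1" "x = \<alpha> ^ k"
proof -
  have "x \<in> (\<lambda>k. \<alpha> ^ k) ` {..<CARD('a) - 1}"
    using bij_betw_imp_surj_on[OF primitive_element_bij_betw[OF assms(1)]] assms(2) by simp
  then show ?thesis
    using that by auto
qed

lemma primitive_element_power_eq_iff:
  fixes \<alpha> :: "'a::{field,finite}"
  assumes "primitive_element \<alpha>"
  shows "\<alpha> ^ i = \<alpha> ^ j \<longleftrightarrow> [i = j] (mod (CARD('a) - 1))"
proof -
  have nz: "\<alpha> \<noteq> 0"
    using assms by (rule primitive_element_nonzero)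
  have "\<alpha> ^ i = \<alpha> ^ j \<longleftrightarrow>
      \<alpha> ^ (i mod (CARD('a) - 1)) = \<alpha> ^ (j mod (CARD('a) - 1))"
    by (simp only: power_mod_card_minus_1[OF nz])
  also have "\<dots> \<longleftrightarrow> i mod (CARD('a) - 1) = j mod (CARD('a) - 1)"
    using inj_on_eq_iff[OF bij_betw_imp_inj_on[OF primitive_element_bij_betw[OF assms]]]
      finite_field_card_gt_1[where 'a='a] by simp
  finally show ?thesis
    by (simp add: cong_def)
qed

text \<open>Both sides say that s is invertible modulo q - 1: an inverse t is an exponent that
  recovers \<open>\<alpha>\<close> from \<open>\<alpha> ^ s\<close>.\<close>

lemma primitive_element_power_iff:
  fixes \<alpha> :: "'a::{field,finite}"
  assumes "primitive_element \<alpha>"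
  shows "primitive_element (\<alpha> ^ s) \<longleftrightarrow> coprime s (CARD('a) - 1)"
proof
  assume "primitive_element (\<alpha> ^ s)"
  then obtain t where "\<alpha> = (\<alpha> ^ s) ^ t"
    using primitive_element_nonzero[OF assms] by (auto simp: primitive_element_iff)
  then have "\<alpha> ^ (s * t) = \<alpha> ^ Suc 0"
    by (simp add: power_mult)
  then show "coprime s (CARD('a) - 1)"
    using primitive_element_power_eq_iff[OF assms] coprime_iff_invertible_nat by blast
next
  assume "coprime s (CARD('a) - 1)"
  then obtain t where "[s * t = Suc 0] (mod (CARD('a) - 1))"
    using coprime_iff_invertible_nat by blast
  then have \<alpha>: "(\<alpha> ^ s) ^ t = \<alpha>"
    using primitive_element_power_eq_iff[OF assms, of "s * t" "Suc 0"] by (simp add: power_mult)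
  have "\<exists>k. x = (\<alpha> ^ s) ^ k" if "x \<noteq> 0" for x
  proof -
    obtain k where "x = \<alpha> ^ k"
      using primitive_element_powE[OF assms \<open>x \<noteq> 0\<close>] .
    then have "x = (\<alpha> ^ s) ^ (t * k)"
      by (simp add: power_mult \<alpha>)
    then show ?thesis ..
  qed
  then show "primitive_element (\<alpha> ^ s)"
    using primitive_element_nonzero[OF assms] by (simp add: primitive_element_iff)
qed

section \<open>Costas maps and orthomorphisms\<close>

text \<open>Serves to turn a map into a formal polynomial. Points are added one at a time: the
  correction is a multiple of a product vanishing on S but not at y.\<close>

lemma poly_interpolation_exists:
  fixes v :: "'a::field \<Rightarrow> 'a"
  assumes "finite S"
  shows "\<exists>f. \<forall>x\<in>S. poly f x = v x"
  using assms
proof (induction S)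
  case (insert y S)
  then obtain f where f: "\<forall>x\<in>S. poly f x = v x"
    by blast
  define w where "w = (\<Prod>a\<in>S. [:- a, 1:])"
  have "poly w y \<noteq> 0" "\<forall>x\<in>S. poly w x = 0"
    using insert.hyps by (auto simp: w_def poly_prod)
  then have "\<forall>x\<in>insert y S. poly (f + smult ((v y - poly f y) / poly w y) w) x = v x"
    using f by simp
  then show ?case by blast
qed auto

lemma costas_poly_iff:
  "costas_poly f \<longleftrightarrow>
     poly f 0 = 0 \<and> (\<forall>d. d \<noteq> 1 \<longrightarrow> bij (\<lambda>x. poly f (d * x) - poly f x))"
proof -
  have "poly (pcompose f [:0, d:] - f) = (\<lambda>x. poly f (d * x) - poly f x)" for d
    by (simp add: fun_eq_iff poly_pcompose mult.commute)
  then show ?thesis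
    by (simp add: costas_poly_def permutation_poly_def)
qed

lemma bij_uminus_comp_iff:
  fixes f :: "'b \<Rightarrow> 'a::ab_group_add"
  shows "bij (\<lambda>x. - f x) \<longleftrightarrow> bij f"
  using bij_comp[of "\<lambda>x. - f x" uminus] bij_comp[of f uminus] bij_uminus[where 'a='a]
  by (auto simp: o_def)

text \<open>For d = 0 the difference in the Costas condition is -f.\<close>

lemma costas_poly_bij:
  assumes "costas_poly f"
  shows "bij (poly f)"
proof -
  have "bij (\<lambda>x. poly f (0 * x) - poly f x)"
    using assms unfolding costas_poly_iff by (metis zero_neq_one)
  then show ?thesis
    using assms by (simp add: costas_poly_iff bij_uminus_comp_iff)
qed

lemma funpow_intertwine:
  fixes \<alpha> :: "'a::monoid_mult"
  assumes "\<And>x. f (\<alpha> * x) = g (f x)"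
  shows "f (\<alpha> ^ k * x) = (g ^^ k) (f x)"
  by (induction k) (simp_all add: assms mult.assoc)

text \<open>The factors d other than 0 and 1 are exactly the powers \<open>\<alpha> ^ k\<close> with
  1 \<le> k \<le> q - 2, so the two conditions match one k at a time; d = 0 only asks that f be
  bijective.\<close>

lemma costas_poly_iff_all_powers_orthomorphism:
  fixes f :: "'a::{field,finite} poly"
  assumes card: "CARD('a) \<noteq> 2" and prim: "primitive_element \<alpha>" and bij: "bij (poly f)"
    and f0: "poly f 0 = 0" and g: "\<And>x. poly f (\<alpha> * x) = g (poly f x)"
  shows "costas_poly f \<longleftrightarrow> all_powers_orthomorphism g"
proof -
  define N where "N = CARD('a) - 1"
  have N: "N > 1" "CARD('a) - 2 = N - 1"
    using card finite_field_card_gt_1[where 'a='a] by (auto simp: N_def)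
  have nz: "\<alpha> \<noteq> 0"
    using prim by (rule primitive_element_nonzero)
  note pow = funpow_intertwine[of "poly f" \<alpha> g, OF g]
  have bij_pow: "bij (g ^^ k)" for k
  proof -
    \<comment> \<open>This composition is f after multiplication by \<open>\<alpha> ^ k\<close>;
      cancelling the bijection f then leaves \<open>g ^^ k\<close>.\<close>
    have "bij ((g ^^ k) \<circ> poly f)"
    proof -
      have "bij (\<lambda>x. \<alpha> ^ k * x)"
        by (rule bij_betw_byWitness[where f'="\<lambda>x. x / \<alpha> ^ k"]) (use nz in auto)
      then have "bij (poly f \<circ> (\<lambda>x. \<alpha> ^ k * x))"
        using bij by (rule bij_comp)
      then show ?thesis
        by (simp add: o_def pow)
    qed
    then show ?thesis
      using bij_betw_comp_iff[OF bij] by blast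
  qed
  have diff: "bij (\<lambda>x. poly f (\<alpha> ^ k * x) - poly f x) \<longleftrightarrow> bij (\<lambda>x. (g ^^ k) x - x)" for k
    using bij_betw_comp_iff[OF bij, of "\<lambda>x. (g ^^ k) x - x" UNIV] by (simp add: o_def pow)
  have ortho: "orthomorphism (g ^^ k) \<longleftrightarrow> bij (\<lambda>x. poly f (\<alpha> ^ k * x) - poly f x)" for k
    by (simp add: orthomorphism_def bij_pow diff)
  have g0: "g 0 = 0"
    using g[of 0] f0 by simp
  have "costas_poly f \<longleftrightarrow> (\<forall>k\<in>{1..N - 1}. orthomorphism (g ^^ k))"
  proof
    assume *: "costas_poly f"
    show "\<forall>k\<in>{1..N - 1}. orthomorphism (g ^^ k)"
    proof
      fix k assume k: "k \<in> {1..N - 1}"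
      then have "\<alpha> ^ k \<noteq> \<alpha> ^ 0"
        unfolding primitive_element_power_eq_iff[OF prim] cong_def
        using N by (auto simp: N_def)
      then show "orthomorphism (g ^^ k)"
        using * by (simp add: ortho costas_poly_iff)
    qed
  next
    assume *: "\<forall>k\<in>{1..N - 1}. orthomorphism (g ^^ k)"
    have "bij (\<lambda>x. poly f (d * x) - poly f x)" if "d \<noteq> 1" for d
    proof (cases "d = 0")
      case True
      then show ?thesis
        using bij by (simp add: f0 bij_uminus_comp_iff)
    next
      case False
      then obtain k where k: "k < N" "d = \<alpha> ^ k"
        using primitive_element_powE[OF prim] unfolding N_def by blast
      with that have "k \<in> {1..N - 1}"
        by (cases k) auto
      with * k show ?thesis
        by (simp add: ortho)
    qed
    with f0 show "costas_poly f"
      by (simp add: costas_poly_iff)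
  qed
  \<comment> \<open>For q > 2 the range of exponents contains k = 1.\<close>
  moreover have "orthomorphism g" if "\<forall>k\<in>{1..N - 1}. orthomorphism (g ^^ k)"
    using that N by force
  ultimately show ?thesis
    using N g0 by (auto simp: all_powers_orthomorphism_def)
qed

text \<open>The orbit of 1 avoids 0 and cannot return to 1 in fewer than q - 1 steps, so its first q
  - 1 points are distinct and exhaust the nonzero elements.\<close>

lemma all_powers_orthomorphism_single_cycle:
  fixes g :: "'a::{field,finite} \<Rightarrow> 'a"
  assumes "all_powers_orthomorphism g"
  shows "bij_betw (\<lambda>k. (g ^^ k) 1) {..<CARD('a) - 1} (- {0})"
    and "(g ^^ (CARD('a) - 1)) 1 = 1"
proof -
  define N where "N = CARD('a) - 1"
  have N: "N > 0" "CARD('a) - 2 = N - 1"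
    using finite_field_card_gt_1[where 'a='a] by (auto simp: N_def)
  have g: "bij g" "g 0 = 0"
    using assms by (auto simp: all_powers_orthomorphism_def orthomorphism_def)
  have bij: "bij (g ^^ k)" for k
    using g by (simp add: bij_fn)
  have zero: "(g ^^ k) 0 = 0" for k
    by (induction k) (simp_all add: g)
  have nonzero: "(g ^^ k) 1 \<noteq> 0" for k
    using bij[of k] zero[of k] by (metis bij_pointE zero_neq_one)
  \<comment> \<open>A fixed point 1 would be a second zero of the injective map
    \<open>(g ^^ k) x - x\<close>, which already vanishes at 0.\<close>
  have no_fix: "(g ^^ k) 1 \<noteq> 1" if "0 < k" "k < N" for k
  proof
    assume "(g ^^ k) 1 = 1"
    moreover have "inj (\<lambda>x. (g ^^ k) x - x)"
      using assms that N
      by (auto simp: all_powers_orthomorphism_def orthomorphism_def bij_is_inj)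
    ultimately have "(1::'a) = 0"
      by (auto dest!: injD[where x=1 and y=0] simp: zero)
    then show False by simp
  qed
  have period: "(g ^^ (j - i)) 1 = 1" if "i < j" "(g ^^ i) 1 = (g ^^ j) 1" for i j
  proof -
    have "(g ^^ i) ((g ^^ (j - i)) 1) = (g ^^ (i + (j - i))) 1"
      by (simp only: funpow_add o_apply)
    also have "\<dots> = (g ^^ i) 1"
      using that by simp
    finally show ?thesis
      using bij_is_inj[OF bij] by (simp add: inj_eq)
  qed
  have "inj_on (\<lambda>k. (g ^^ k) 1) {..<N}"
  proof (rule linorder_inj_onI')
    fix i j assume "i \<in> {..<N}" "j \<in> {..<N}" "i < j"
    then show "(g ^^ i) 1 \<noteq> (g ^^ j) 1"
      using period[of i j] no_fix[of "j - i"] by auto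
  qed
  moreover from this have "(\<lambda>k. (g ^^ k) 1) ` {..<N} = - {0}"
    by (intro card_seteq) (auto simp: nonzero card_image card_nonzero N_def)
  ultimately have bij_betw: "bij_betw (\<lambda>k. (g ^^ k) 1) {..<N} (- {0})"
    by (simp add: bij_betw_def)
  then show "bij_betw (\<lambda>k. (g ^^ k) 1) {..<CARD('a) - 1} (- {0})"
    by (simp only: N_def)
  \<comment> \<open>The N-th point repeats some j-th one with j < N; for j > 0 the period N - j
    would be too short, so the cycle closes at 1.\<close>
  have "(g ^^ N) 1 \<in> (\<lambda>k. (g ^^ k) 1) ` {..<N}"
    using bij_betw_imp_surj_on[OF bij_betw] nonzero by simp
  then obtain j where j: "j < N" "(g ^^ j) 1 = (g ^^ N) 1"
    by auto
  then have "(g ^^ (N - j)) 1 = 1"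
    by (intro period)
  with j no_fix[of "N - j"] have "j = 0"
    by (cases j) auto
  with j show "(g ^^ (CARD('a) - 1)) 1 = 1"
    by (simp add: N_def)
qed

text \<open>Matches the cycle of powers of \<open>\<alpha>\<close> with the g-orbit of 1, both of
  length q - 1, and sends 0 to 0.\<close>

lemma all_powers_orthomorphism_conjugator:
  fixes g :: "'a::{field,finite} \<Rightarrow> 'a"
  assumes g: "all_powers_orthomorphism g" and prim: "primitive_element \<alpha>"
  obtains f where "bij (poly f)" "poly f 0 = 0" "\<And>x. poly f (\<alpha> * x) = g (poly f x)"
proof -
  define N where "N = CARD('a) - 1"
  have N: "N > 0"
    using finite_field_card_gt_1[where 'a='a] by (auto simp: N_def)
  note cycle = all_powers_orthomorphism_single_cycle[OF g, folded N_def]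
  have pow: "bij_betw (\<lambda>k. \<alpha> ^ k) {..<N} (- {0})"
    using primitive_element_bij_betw[OF prim] by (simp add: N_def)
  \<comment> \<open>The discrete logarithm to base \<open>\<alpha>\<close>, with values below q -
    1.\<close>
  define dlog where "dlog = the_inv_into {..<N} (\<lambda>k. \<alpha> ^ k)"
  have dlog: "dlog (\<alpha> ^ k) = k" if "k < N" for k
    using that bij_betw_imp_inj_on[OF pow] by (simp add: dlog_def the_inv_into_f_f)
  have "bij_betw ((\<lambda>k. (g ^^ k) 1) \<circ> dlog) (- {0}) (- {0})"
    unfolding dlog_def by (rule bij_betw_trans[OF bij_betw_the_inv_into[OF pow] cycle(1)])
  moreover obtain f where f: "poly f x = (if x = 0 then 0 else (g ^^ dlog x) 1)" for x
    using poly_interpolation_exists[of UNIV "\<lambda>x::'a. if x = 0 then 0 else (g ^^ dlog x) 1"]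
    by auto
  ultimately have "bij_betw (poly f) (- {0}) (- {0})"
    by (subst bij_betw_cong[where g="(\<lambda>k. (g ^^ k) 1) \<circ> dlog"]) auto
  moreover have f0: "poly f 0 = 0"
    by (simp add: f)
  ultimately have "bij_betw (poly f) (- {0} \<union> {0}) (- {0} \<union> {0})"
    by (intro bij_betw_combine) (auto simp: bij_betw_def)
  then have "bij (poly f)"
    by (simp only: Compl_partition2)
  moreover have "poly f (\<alpha> * x) = g (poly f x)" for x
  proof (cases "x = 0")
    case True
    then show ?thesis
      using g by (simp add: f0 all_powers_orthomorphism_def)
  next
    case False
    have pow_f: "poly f (\<alpha> ^ k) = (g ^^ k) 1" if "k < N" for k
      using that primitive_element_nonzero[OF prim] by (simp add: f dlog)
    obtain k where k: "k < N" "x = \<alpha> ^ k"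
      using primitive_element_powE[OF prim False] unfolding N_def by blast
    have "poly f (\<alpha> ^ Suc k) = (g ^^ Suc k) 1"
    \<comment> \<open>At k = N - 1 the logarithm wraps around to 0; both cycles close there, as
      \<open>\<alpha> ^ N = 1\<close> and \<open>(g ^^ N) 1 = 1\<close>.\<close>
    proof (cases "Suc k < N")
      case False
      with k have Suc: "Suc k = N"
        by simp
      have "\<alpha> ^ N = \<alpha> ^ 0"
        using finite_field_power_card_minus_1[OF primitive_element_nonzero[OF prim]]
        by (simp add: N_def)
      then show ?thesis
        using pow_f[of 0] N cycle(2) by (simp only: Suc) simp
    qed (rule pow_f)
    with k show ?thesis
      by (simp add: pow_f)
  qed
  ultimately show ?thesis
    using f0 that by blast
qed

text \<open>Replaces the compositional inverse by an intertwining equation, the form in which all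
  later arguments handle the conjugate.\<close>

lemma conj_mult_unique:
  assumes "bij (poly f)"
  shows "g = conj_mult f \<alpha> \<longleftrightarrow> (\<forall>x. poly f (\<alpha> * x) = g (poly f x))"
proof
  assume "g = conj_mult f \<alpha>"
  then show "\<forall>x. poly f (\<alpha> * x) = g (poly f x)"
    using assms by (simp add: conj_mult_def bij_is_inj)
next
  assume *: "\<forall>x. poly f (\<alpha> * x) = g (poly f x)"
  show "g = conj_mult f \<alpha>"
  proof
    fix y
    show "g y = conj_mult f \<alpha> y"
      using assms * by (simp add: conj_mult_def bij_is_surj surj_f_inv_f)
  qed
qed

lemma costas_poly_conj_mult:
  fixes f :: "'a::{field,finite} poly"
  assumes "CARD('a) \<noteq> 2" "primitive_element \<alpha>" "costas_poly f"
  shows "all_powers_orthomorphism (conj_mult f \<alpha>)"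
proof -
  have bij: "bij (poly f)"
    using assms(3) by (rule costas_poly_bij)
  then show ?thesis
    using costas_poly_iff_all_powers_orthomorphism[OF assms(1,2) bij, of "conj_mult f \<alpha>"]
      conj_mult_unique[OF bij, of "conj_mult f \<alpha>" \<alpha>] assms(3)
    by (simp add: costas_poly_iff)
qed

lemma all_powers_orthomorphism_imp_conj_mult:
  fixes g :: "'a::{field,finite} \<Rightarrow> 'a"
  assumes "CARD('a) \<noteq> 2" "primitive_element \<alpha>" "all_powers_orthomorphism g"
  obtains f where "costas_poly f" "g = conj_mult f \<alpha>"
proof -
  obtain f where f: "bij (poly f)" "poly f 0 = 0" "\<And>x. poly f (\<alpha> * x) = g (poly f x)"
    using all_powers_orthomorphism_conjugator[OF assms(3,2)] by blast
  then have "costas_poly f"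
    using costas_poly_iff_all_powers_orthomorphism[OF assms(1,2) f] assms(3) by blast
  moreover have "g = conj_mult f \<alpha>"
    using conj_mult_unique[OF f(1)] f(3) by blast
  ultimately show ?thesis
    using that by blast
qed

section \<open>Linearized permutation polynomials\<close>

text \<open>A permutation of {0, 1} fixing 0 is the identity, and subtracting x leaves the zero
  map.\<close>

lemma no_orthomorphism_card_2:
  fixes g :: "'a::{field,finite} \<Rightarrow> 'a"
  assumes "CARD('a) = 2"
  shows "\<not> all_powers_orthomorphism g"
proof
  assume *: "all_powers_orthomorphism g"
  have UNIV: "UNIV = {0, 1 :: 'a}"
    by (rule card_seteq[symmetric]) (simp_all add: assms)
  have g: "bij g" "g 0 = 0" "inj (\<lambda>x. g x - x)"
    using * by (auto simp: all_powers_orthomorphism_def orthomorphism_def bij_is_inj)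
  have "g 1 \<noteq> 0"
    using bij_is_inj[OF g(1)] g(2) by (metis injD zero_neq_one)
  then have "g 1 = 1"
    using UNIV by blast
  then show False
    using injD[OF g(3), of 1 0] g(2) by simp
qed

lemma linearized_permutation_poly_0:
  assumes "linearized_permutation_poly p n L" "p > 0"
  shows "poly L 0 = 0"
  using assms by (auto simp: linearized_permutation_poly_def poly_sum poly_monom power_0_left)

text \<open>The factor c is absorbed into the coefficients, which become
  \<open>a i * c ^ (p ^ i)\<close>.\<close>

lemma linearized_permutation_poly_scale:
  fixes c :: "'a::{field,finite}"
  assumes "linearized_permutation_poly p n L" "c \<noteq> 0"
  obtains M where "linearized_permutation_poly p n M" "poly M = (\<lambda>x. poly L (c * x))"
proof -
  obtain a where a: "L = (\<Sum>i<n. monom (a i) (p ^ i))" and bij: "bij (poly L)"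
    using assms(1) by (auto simp: linearized_permutation_poly_def permutation_poly_def)
  define M where "M = (\<Sum>i<n. monom (a i * c ^ (p ^ i)) (p ^ i))"
  have M: "poly M = (\<lambda>x. poly L (c * x))"
    by (simp add: fun_eq_iff a M_def poly_sum poly_monom power_mult_distrib mult.assoc)
  have "bij (\<lambda>x. c * x)"
    by (rule bij_betw_byWitness[where f'="\<lambda>x. x / c"]) (use assms(2) in auto)
  then have "bij (poly L \<circ> (\<lambda>x. c * x))"
    using bij by (rule bij_comp)
  then have "linearized_permutation_poly p n M"
    unfolding linearized_permutation_poly_def permutation_poly_def M
    by (auto simp: o_def M_def)
  with M show ?thesis
    using that by blast
qed

text \<open>Taking s-th powers turns multiplication by \<open>\<alpha>\<close> into multiplication
  by \<open>\<alpha> ^ s\<close>.\<close>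

lemma conj_mult_power_comp:
  fixes f L :: "'a::{field,finite} poly"
  assumes f: "bij (poly f)" "poly f = (\<lambda>x. poly L (x ^ s))" and L: "bij (poly L)"
  shows "conj_mult f \<alpha> = conj_mult L (\<alpha> ^ s)"
proof -
  have "poly f (\<alpha> * x) = conj_mult L (\<alpha> ^ s) (poly f x)" for x
    using L by (simp add: f(2) conj_mult_def bij_is_inj power_mult_distrib)
  then show ?thesis
    using conj_mult_unique[OF f(1)] by metis
qed

text \<open>Iterating from 1 determines h on all powers of \<open>\<alpha>\<close>, hence at every
  nonzero x; at 0 the positive exponent makes \<open>x ^ s\<close> vanish.\<close>

lemma intertwine_imp_monomial:
  fixes h :: "'a::{field,finite} \<Rightarrow> 'a"
  assumes "primitive_element \<alpha>" "h 0 = 0" "\<And>x. h (\<alpha> * x) = \<alpha> ^ s * h x" "s > 0"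
  shows "h x = h 1 * x ^ s"
proof (cases "x = 0")
  case False
  then obtain k where "x = \<alpha> ^ k"
    using assms(1) by (auto simp: primitive_element_iff)
  moreover have "h (\<alpha> ^ k) = h 1 * (\<alpha> ^ k) ^ s"
    by (induction k) (simp_all add: assms(3) power_mult_distrib mult_ac)
  ultimately show ?thesis
    by simp
qed (use assms in simp)

text \<open>Equal conjugates make L^-1 f intertwine multiplication by \<open>\<alpha>\<close> and by
  \<open>\<beta> = \<alpha> ^ s\<close>, so it is a monomial c x^s, and M(x) = L(c x) absorbs
  c.\<close>

lemma conj_mult_linearized_imp_power_comp:
  fixes f L :: "'a::{field,finite} poly"
  assumes f: "bij (poly f)" "poly f 0 = 0"
    and L: "linearized_permutation_poly p n L" "p > 0"
    and prim: "primitive_element \<alpha>" "primitive_element \<beta>"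
    and conj: "conj_mult f \<alpha> = conj_mult L \<beta>"
  obtains M s where "linearized_permutation_poly p n M" "s > 0" "gcd s (CARD('a) - 1) = 1"
    "poly f = (\<lambda>x. poly M (x ^ s))"
proof -
  have bij: "bij (poly L)"
    using L by (simp add: linearized_permutation_poly_def permutation_poly_def)
  obtain s0 where s0: "\<beta> = \<alpha> ^ s0"
    using prim primitive_element_nonzero by (auto simp: primitive_element_iff)
  \<comment> \<open>The exponent is shifted by the order of \<open>\<alpha>\<close> to make it positive also for \<open>q = 2\<close>.\<close>
  define s where "s = s0 + (CARD('a) - 1)"
  have s: "s > 0" "\<beta> = \<alpha> ^ s"
    using finite_field_card_gt_1[where 'a='a]
      finite_field_power_card_minus_1[OF primitive_element_nonzero[OF prim(1)]]
    by (simp_all only: s_def s0 power_add) simp_all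
  have coprime: "gcd s (CARD('a) - 1) = 1"
    using prim s(2) primitive_element_power_iff coprime_iff_gcd_eq_1 by blast
  define h where "h x = Hilbert_Choice.inv (poly L) (poly f x)" for x
  have Lh: "poly L (h x) = poly f x" for x
    using bij by (simp add: h_def bij_is_surj surj_f_inv_f)
  have "poly L (h (\<alpha> * x)) = poly L (\<alpha> ^ s * h x)" for x
  proof -
    have "poly L (h (\<alpha> * x)) = conj_mult f \<alpha> (poly f x)"
      using conj_mult_unique[OF f(1)] Lh by metis
    also have "\<dots> = conj_mult L \<beta> (poly L (h x))"
      by (simp only: conj Lh)
    also have "\<dots> = poly L (\<alpha> ^ s * h x)"
      using conj_mult_unique[OF bij] s(2) by metis
    finally show ?thesis .
  qed
  then have "h (\<alpha> * x) = \<alpha> ^ s * h x" for x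
    using bij_is_inj[OF bij] by (simp add: inj_eq)
  moreover have L0: "poly L 0 = 0"
    using L by (rule linearized_permutation_poly_0)
  then have "h 0 = 0"
    using Lh[of 0] f(2) bij_is_inj[OF bij] by (metis injD)
  ultimately have h: "h x = h 1 * x ^ s" for x
    using intertwine_imp_monomial[OF prim(1)] s(1) by blast
  \<comment> \<open>Otherwise f(1) = L(0) = 0 = f(0), against injectivity.\<close>
  have "h 1 \<noteq> 0"
    using Lh[of 1] L0 f bij_is_inj[OF f(1)] by (metis injD zero_neq_one)
  then obtain M where M: "linearized_permutation_poly p n M" "poly M = (\<lambda>x. poly L (h 1 * x))"
    using linearized_permutation_poly_scale[OF L(1)] by blast
  have "poly f = (\<lambda>x. poly M (x ^ s))"
  proof
    fix x
    have "poly f x = poly L (h x)"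
      by (rule Lh[symmetric])
    also have "\<dots> = poly M (x ^ s)"
      by (simp only: M(2) h[of x])
    finally show "poly f x = poly M (x ^ s)" .
  qed
  then show ?thesis
    by (rule that[OF M(1) s(1) coprime])
qed

lemma costas_poly_card_2:
  fixes f :: "'a::{field,finite} poly"
  assumes "CARD('a) = 2" "costas_poly f"
  shows "poly f = (\<lambda>x. x)"
proof
  fix x :: 'a
  have UNIV: "UNIV = {0, 1 :: 'a}"
    by (rule card_seteq[symmetric]) (simp_all add: assms)
  have f0: "poly f 0 = 0"
    using assms by (simp add: costas_poly_iff)
  then have "poly f 1 \<noteq> 0"
    using bij_is_inj[OF costas_poly_bij[OF assms(2)]] by (metis injD zero_neq_one)
  then have "poly f 1 = 1"
    using UNIV by blast
  with f0 UNIV show "poly f x = x"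
    by (metis UNIV_I insertE singletonD)
qed

text \<open>Provides L(x) = x for the field of order 2, where the only Costas map is the
  identity.\<close>

lemma linearized_permutation_poly_X:
  assumes "n > 0"
  shows "linearized_permutation_poly p n (monom (1::'a::{field,finite}) 1)"
proof -
  have "(\<Sum>i<n. monom (if i = 0 then 1 else 0) (p ^ i)) = (monom 1 1 :: 'a poly)"
    using assms by (subst sum.remove[of _ 0]) auto
  moreover have "poly (monom (1::'a) 1) = id"
    by (simp add: fun_eq_iff poly_monom)
  ultimately show ?thesis
    unfolding linearized_permutation_poly_def permutation_poly_def by (metis bij_id)
qed

theorem theorem2p1:
  fixes p n q :: nat
  assumes "prime p" and "n > 0" and "q = p ^ n"
    and "CARD('a::{field,finite}) = q"
  shows
    "(q \<noteq> 2 \<longrightarrow>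
       ((\<exists>f::'a poly. costas_poly f) \<longleftrightarrow> (\<exists>g::'a \<Rightarrow> 'a. all_powers_orthomorphism g)) \<and>
       (\<forall>\<alpha>::'a. primitive_element \<alpha> \<longrightarrow>
          (\<forall>f. costas_poly f \<longrightarrow> all_powers_orthomorphism (conj_mult f \<alpha>)) \<and>
          (\<forall>g. all_powers_orthomorphism g \<longrightarrow> (\<exists>f. costas_poly f \<and> g = conj_mult f \<alpha>)))) \<and>
     ((\<forall>f::'a poly. costas_poly f \<longrightarrow>
         (\<exists>L s. linearized_permutation_poly p n L \<and> s > 0 \<and> gcd s (q - 1) = 1 \<and>
                poly f = (\<lambda>x. poly L (x ^ s)))) \<longleftrightarrow>
      (\<forall>g::'a \<Rightarrow> 'a. all_powers_orthomorphism g \<longrightarrow>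
         (\<exists>L \<alpha>. linearized_permutation_poly p n L \<and> primitive_element \<alpha> \<and>
                g = conj_mult L \<alpha>)))"
proof -
  have p: "p > 0"
    using \<open>prime p\<close> by (rule prime_gt_0_nat)
  have card: "CARD('a) = q"
    by fact
  obtain \<alpha> :: 'a where \<alpha>: "primitive_element \<alpha>"
    using primitive_element_exists by blast
  have "(\<exists>f::'a poly. costas_poly f) \<longleftrightarrow> (\<exists>g::'a \<Rightarrow> 'a. all_powers_orthomorphism g)"
    if "q \<noteq> 2"
    using that \<alpha> costas_poly_conj_mult all_powers_orthomorphism_imp_conj_mult card by metis
  moreover have "(\<forall>f. costas_poly f \<longrightarrow> all_powers_orthomorphism (conj_mult f \<alpha>)) \<and>
      (\<forall>g. all_powers_orthomorphism g \<longrightarrow> (\<exists>f. costas_poly f \<and> g = conj_mult f \<alpha>))"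
    if "q \<noteq> 2" "primitive_element \<alpha>" for \<alpha> :: 'a
    using that costas_poly_conj_mult all_powers_orthomorphism_imp_conj_mult card by metis
  moreover have "(\<forall>f::'a poly. costas_poly f \<longrightarrow>
      (\<exists>L s. linearized_permutation_poly p n L \<and> s > 0 \<and> gcd s (q - 1) = 1 \<and>
             poly f = (\<lambda>x. poly L (x ^ s)))) \<longleftrightarrow>
    (\<forall>g::'a \<Rightarrow> 'a. all_powers_orthomorphism g \<longrightarrow>
      (\<exists>L \<alpha>. linearized_permutation_poly p n L \<and> primitive_element \<alpha> \<and> g = conj_mult L \<alpha>))"
    (is "?costas \<longleftrightarrow> ?ortho")
  \<comment> \<open>For q = 2 both sides hold: every Costas map is x = L(x^1) with L(x) = x, and no
    g satisfies the orthomorphism condition.\<close>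
  proof (cases "q = 2")
    case True
    have "poly f = (\<lambda>x. poly (monom 1 1) (x ^ 1))" if "costas_poly f" for f :: "'a poly"
      using costas_poly_card_2[OF _ that] True card by (simp add: poly_monom)
    then have ?costas
      using linearized_permutation_poly_X[OF \<open>n > 0\<close>]
      by (intro allI impI exI[of _ "monom 1 1"] exI[of _ "1::nat"]) simp
    moreover have ?ortho
      using no_orthomorphism_card_2 True card by blast
    ultimately show ?thesis
      by blast
  next
    case False
    then have card2: "CARD('a) \<noteq> 2"
      using card by simp
    show ?thesis
    proof (intro iffI allI impI)
      fix g :: "'a \<Rightarrow> 'a"
      \<comment> \<open>Writing g as the conjugate by f = L(x^s) makes it the conjugate by L of
        multiplication by \<open>\<alpha> ^ s\<close>, which is primitive because s is coprime to q
        - 1.\<close>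
      assume costas: ?costas and "all_powers_orthomorphism g"
      then obtain f where f: "costas_poly f" "g = conj_mult f \<alpha>"
        using all_powers_orthomorphism_imp_conj_mult[OF card2 \<alpha>] by blast
      from costas[rule_format, OF f(1)] obtain L s
        where L: "linearized_permutation_poly p n L"
          "gcd s (q - 1) = 1" "poly f = (\<lambda>x. poly L (x ^ s))"
        by (elim exE conjE)
      have "bij (poly L)"
        using L(1) by (simp add: linearized_permutation_poly_def permutation_poly_def)
      then have "g = conj_mult L (\<alpha> ^ s)"
        using conj_mult_power_comp[OF costas_poly_bij[OF f(1)] L(3)] f(2) by simp
      moreover have "primitive_element (\<alpha> ^ s)"
        using L(2) card by (simp add: primitive_element_power_iff[OF \<alpha>] coprime_iff_gcd_eq_1)
      ultimately show "\<exists>L \<alpha>. linearized_permutation_poly p n L \<and> primitive_element \<alpha> \<and>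
          g = conj_mult L \<alpha>"
        using L(1) by blast
    next
      fix f :: "'a poly"
      \<comment> \<open>The conjugate by f also has a linearized form, possibly with another
        primitive element \<open>\<beta>\<close>; comparing the two recovers f.\<close>
      assume ortho: ?ortho and f: "costas_poly f"
      then obtain L \<beta> where L: "linearized_permutation_poly p n L" and \<beta>: "primitive_element \<beta>"
        and conj: "conj_mult f \<alpha> = conj_mult L \<beta>"
        using costas_poly_conj_mult[OF card2 \<alpha> f] by blast
      have "poly f 0 = 0"
        using f by (simp add: costas_poly_iff)
      from conj_mult_linearized_imp_power_comp[OF costas_poly_bij[OF f] this L p \<alpha> \<beta> conj]
      show "\<exists>L s. linearized_permutation_poly p n L \<and> s > 0 \<and> gcd s (q - 1) = 1 \<and>
          poly f = (\<lambda>x. poly L (x ^ s))"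
        unfolding card by metis
    qed
  qed
  ultimately show ?thesis
    by blast
qed

end
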